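(* Let $f\in\overline{\mathrm{co}(S^* )}$, $f(z)=z+\sum_{k=2}^\infty a_kz^k$, and let $m,n\ge2$ be integers. Then $$\left|\frac{a_ma_n}{mn}-\frac{a_{m+n-1}}{m+n-1}\right|+\frac{|a_ma_n|}{mn}\le1.$$ This statement is equivalent to $$|\lambda a_ma_n-a_{m+n-1}|\le(m+n-1)\max\left\{1,\left|1-\frac{mn}{m+n-1}\lambda\right|\right\}\quad\text{for all }\lambda\in\mathbb{C}.$$ In both cases, equality holds for the function $$f(z)=\frac{z}{(1-z)^2}$$ when $\left|1-\frac{mn}{m+n-1}\lambda\right|\ge1$, and for the function $$f(z)=\frac{z}{1-z^{m+n-2}}+(m+n-2)\frac{z^{m+n-1}}{(1-z^{m+n-2})^2}$$ when $\left|1-\frac{mn}{m+n-1}\lambda\right|<1$.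
   Context: $\mathbb{D}$ is the open unit disk in $\mathbb{C}$. $S$ is the class of all univalent (analytic and one-to-one) functions $f$ in $\mathbb{D}$ with Taylor series $f(z)=z+\sum_{n=2}^\infty a_nz^n$. A set $E$ is starlike with respect to the origin if for every $z\in E$ the segment $[0,z]$ is contained in $E$. $S^*$ is the class of all $f\in S$ for which $f(\mathbb{D})$ is starlike with respect to the origin. $\mathrm{co}(S^* )$ is the convex hull of $S^*$ and $\overline{\mathrm{co}(S^* )}$ is its closure in the topology of uniform convergence on compact subsets of $\mathbb{D}$. *)

theory Defs
  imports "HOL-Complex_Analysis.Complex_Analysis"
begin

abbreviation unit_disc :: "complex set" where
  "unit_disc \<equiv> ball 0 1"

text \<open>
  Functions on the disc are total functions on \<^typ>\<open>complex\<close>; their values outside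
  the disc are irrelevant to every notion below.
\<close>

definition taylor_coeff :: "(complex \<Rightarrow> complex) \<Rightarrow> nat \<Rightarrow> complex" where
  "taylor_coeff f k = fps_nth (fps_expansion f 0) k"

definition class_S :: "(complex \<Rightarrow> complex) set" where
  "class_S = {f. f holomorphic_on unit_disc \<and> inj_on f unit_disc \<and>
                 taylor_coeff f 0 = 0 \<and> taylor_coeff f 1 = 1}"

text \<open>
  The library predicate \<^const>\<open>starlike\<close> allows an arbitrary centre, so it cannot be
  used here, where the centre has to be the origin.
\<close>

definition starlike_wrt_origin :: "complex set \<Rightarrow> bool" where
  "starlike_wrt_origin E \<longleftrightarrow> (\<forall>w\<in>E. closed_segment 0 w \<subseteq> E)"

definition class_S_star :: "(complex \<Rightarrow> complex) set" where
  "class_S_star = {f \<in> class_S. starlike_wrt_origin (f ` unit_disc)}"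

text \<open>
  The type \<^typ>\<open>complex \<Rightarrow> complex\<close> is not an instance of \<^class>\<open>real_vector\<close>, so the
  library's convexity is restated pointwise for sets of functions.
\<close>

definition convex_funs :: "(complex \<Rightarrow> complex) set \<Rightarrow> bool" where
  "convex_funs A \<longleftrightarrow>
     (\<forall>f\<in>A. \<forall>g\<in>A. \<forall>u v :: real. 0 \<le> u \<longrightarrow> 0 \<le> v \<longrightarrow> u + v = 1 \<longrightarrow>
        (\<lambda>z. of_real u * f z + of_real v * g z) \<in> A)"

definition compact_nbhd ::
    "(complex \<Rightarrow> complex) \<Rightarrow> complex set \<Rightarrow> real \<Rightarrow> (complex \<Rightarrow> complex) set" where
  "compact_nbhd f K e =
     {g. g holomorphic_on unit_disc \<and> (\<forall>z\<in>K. cmod (g z - f z) < e)}"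

text \<open>
  The topology of uniform convergence on compact subsets of the disc, on the space of all
  functions holomorphic there. By continuity the bound in \<^const>\<open>compact_nbhd\<close> is the
  same as a strict bound on the supremum over the compact set.
\<close>

definition compact_convergence_topology :: "(complex \<Rightarrow> complex) topology" where
  "compact_convergence_topology = topology_generated_by
     {compact_nbhd f K e | f K e.
        f holomorphic_on unit_disc \<and> compact K \<and> K \<subseteq> unit_disc \<and> 0 < e}"

definition closed_hull_S_star :: "(complex \<Rightarrow> complex) set" where
  "closed_hull_S_star =
     compact_convergence_topology closure_of (convex_funs hull class_S_star)"

end

theory Submission
  imports Defs
begin

text \<open>
  For $f$ starlike put $h(z) = \frac1z \int_0^z f(\zeta)/\zeta\,d\zeta = \sum_k c_k z^k$ with
  $c_k = a_{k+1}/(k+1)$. Two applications of Jack's lemma give $\mathrm{Re}\,(z f'/f) > 0$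
  $\Rightarrow$ $\mathrm{Re}\,(f/(zh)) > \frac12$ $\Rightarrow$ $\mathrm{Re}\,h > \frac12$, so the
  $c_k$ behave like the moments of a probability measure on the circle. Integrating
  $|a + b x^i + \bar x^j|^2$ with $|b| = 1$ yields
  $|a|^2 + 2 + 2\,\mathrm{Re}\,(\bar a b c_i + a c_j + b c_{i+j}) \ge 0$, a condition affine and
  continuous in $f$, hence valid on the whole closed convex hull. Taking
  $a = -(b c_i + \overline{c_j})$ and the best $b$ leaves
  $|c_i c_j - c_{i+j}| \le 1 - \frac12(|c_i|^2 + |c_j|^2) \le 1 - |c_i c_j|$.
  The second extremal function is the average of the rotated Koebe functions
  $z/(1-xz)^2$ over the roots of unity $x$ of order $m+n-2$.
\<close>

section \<open>Starlike functions and Jack's lemma\<close>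

text \<open>The difference of the squared norms vanishes at 0 and has derivative
  \<open>2 * (A 0 \<bullet> a) - 2 * (B 0 \<bullet> b)\<close> there; a positive derivative would
  make \<open>A\<close> longer than \<open>B\<close> just to the right of 0.\<close>

lemma inner_derivative_le_if_norm_le:
  fixes A :: "real \<Rightarrow> 'a::real_inner" and B :: "real \<Rightarrow> 'b::real_inner"
  assumes A: "(A has_vector_derivative a) (at 0)" and B: "(B has_vector_derivative b) (at 0)"
    and eq: "norm (A 0) = norm (B 0)"
    and "0 < d" and le: "\<And>s. 0 < s \<Longrightarrow> s < d \<Longrightarrow> norm (A s) \<le> norm (B s)"
  shows "A 0 \<bullet> a \<le> B 0 \<bullet> b"
proof (rule ccontr)
  assume *: "\<not> A 0 \<bullet> a \<le> B 0 \<bullet> b"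
  have inner_deriv: "((\<lambda>s. C s \<bullet> C s) has_real_derivative 2 * (C 0 \<bullet> c)) (at 0)"
    if "(C has_vector_derivative c) (at 0)" for C :: "real \<Rightarrow> 'c::real_inner" and c
    using has_derivative_inner[OF that[unfolded has_vector_derivative_def]
        that[unfolded has_vector_derivative_def]]
    by (simp add: has_field_derivative_def inner_commute algebra_simps mult_commute_abs)
  have "((\<lambda>s. A s \<bullet> A s - B s \<bullet> B s) has_real_derivative 2 * (A 0 \<bullet> a) - 2 * (B 0 \<bullet> b)) (at 0)"
    by (intro DERIV_diff inner_deriv A B)
  from DERIV_pos_inc_right[OF this] * obtain e where e: "e > 0"
    "\<And>h. 0 < h \<Longrightarrow> h < e \<Longrightarrow> A 0 \<bullet> A 0 - B 0 \<bullet> B 0 < A (0 + h) \<bullet> A (0 + h) - B (0 + h) \<bullet> B (0 + h)"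
    by fastforce
  define h where "h = min d e / 2"
  have h: "0 < h" "h < d" "h < e" using \<open>0 < d\<close> e(1) by (auto simp: h_def)
  from e(2)[OF h(1,3)] eq have "(norm (B h))\<^sup>2 < (norm (A h))\<^sup>2"
    by (simp add: dot_square_norm)
  with le[OF h(1,2)] show False
    by (meson norm_ge_zero not_le power_mono)
qed

text \<open>
  Jack's lemma: at a point $p$ of least modulus with $|w(p)| = 1$, the quotient
  $p w'(p)/w(p)$ is real and at least $1$.
\<close>

lemma norm_lt_one_if_no_radial_contact:
  fixes w :: "complex \<Rightarrow> complex"
  assumes hol: "w holomorphic_on ball 0 1" and w0: "w 0 = 0"
    and no: "\<And>z k. z \<in> ball 0 1 \<Longrightarrow> cmod (w z) = 1 \<Longrightarrow> k \<ge> 1 \<Longrightarrow> z * deriv w z \<noteq> of_real k * w z"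
    and z: "z \<in> ball 0 1"
  shows "cmod (w z) < 1"
proof (rule ccontr)
  assume "\<not> cmod (w z) < 1"
  \<comment> \<open>A point of least modulus in the compact set \<open>T\<close> is the contact
    point \<open>p\<close>: on the open disc of radius \<open>r = cmod p\<close> the modulus of
    \<open>w\<close> stays below 1.\<close>
  define T where "T = {x \<in> cball 0 (cmod z). 1 \<le> cmod (w x)}"
  have sub: "cball 0 (cmod z) \<subseteq> ball (0::complex) 1" using z by auto
  have cont: "continuous_on (cball 0 (cmod z)) w"
    using hol sub by (meson holomorphic_on_imp_continuous_on holomorphic_on_subset)
  have "closed T" unfolding T_def
    by (intro continuous_closed_preimage_constant continuous_on_closed_Collect_le
        continuous_on_norm cont continuous_on_const closed_cball)
  moreover have "T \<subseteq> cball 0 (cmod z)" by (auto simp: T_def)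
  ultimately have "compact T"
    by (meson bounded_cball bounded_subset compact_eq_bounded_closed)
  moreover have "z \<in> T" using \<open>\<not> cmod (w z) < 1\<close> by (auto simp: T_def)
  ultimately obtain p where p: "p \<in> T" and pmin: "\<And>x. x \<in> T \<Longrightarrow> cmod p \<le> cmod x"
    using continuous_attains_inf[of T cmod] continuous_on_norm_id by (metis empty_iff)
  define r where "r = cmod p"
  have p1: "r < 1" "1 \<le> cmod (w p)" "p \<in> ball 0 1" using p z by (auto simp: T_def r_def)
  have r0: "r > 0" using p1(2) w0 by (auto simp: r_def)
  have small: "cmod (w x) < 1" if "cmod x < r" for x
    using pmin[of x] that p by (force simp: T_def r_def)
  have contract: "r * x < 1" if "0 \<le> x" "x < 1" for x
    using that r0 p1(1) mult_left_le_one_le[of x r] by linarith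
  have schwarz: "cmod (w (r * x)) \<le> cmod x" if "cmod x < 1" for x :: complex
  proof (rule Schwarz_Lemma(1)[of "\<lambda>x. w (r * x)"])
    show "(\<lambda>x. w (r * x)) holomorphic_on ball 0 1"
      using r0 p1(1)
      by (intro holomorphic_on_compose_gen[OF _ hol, unfolded o_def] holomorphic_intros)
        (auto simp: norm_mult contract)
    show "cmod (w (of_real r * x)) < 1" if "cmod x < 1" for x
      using r0 that by (intro small) (auto simp: norm_mult)
  qed (use w0 that in auto)
  define u where "u = p / r"
  have u: "cmod u = 1" "p = r * u" using r0 by (auto simp: u_def r_def norm_divide)
  have der: "(w has_field_derivative deriv w p) (at p)"
    using hol p1(3) by (intro holomorphic_derivI) auto
  \<comment> \<open>Along the radius the points \<open>(1 - s) * p\<close> lie in the disc of radius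
    \<open>r\<close>, where \<open>cmod w < 1\<close>; continuity carries the weak bound to
    \<open>p\<close>.\<close>
  have le1: "cmod (w p) \<le> 1"
  proof -
    have "((\<lambda>s::real. w (of_real (1 - s) * p)) \<longlongrightarrow> w (of_real (1 - 0) * p)) (at_right 0)"
    proof (rule tendsto_compose[where g = w])
      show "w \<midarrow>of_real (1 - 0) * p\<rightarrow> w (of_real (1 - 0) * p)" using DERIV_isCont[OF der] by (simp add: isCont_def)
      show "((\<lambda>s::real. complex_of_real (1 - s) * p) \<longlongrightarrow> of_real (1 - 0) * p) (at_right 0)"
        by (auto intro!: tendsto_eq_intros)
    qed
    then have "((\<lambda>s::real. cmod (w (of_real (1 - s) * p))) \<longlongrightarrow> cmod (w p)) (at_right 0)"
      by (simp add: tendsto_norm)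
    moreover have "\<forall>\<^sub>F s::real in at_right 0. cmod (w (of_real (1 - s) * p)) \<le> 1"
      unfolding eventually_at_right_field
    proof (intro exI[of _ 1] conjI allI impI)
      fix s :: real assume s: "0 < s" "s < 1"
      have "cmod (w (of_real (1 - s) * p)) < 1"
        using s r0 by (intro small) (simp add: norm_mult flip: r_def del: of_real_diff)
      then show "cmod (w (of_real (1 - s) * p)) \<le> 1" by simp
    qed simp
    ultimately show ?thesis by (rule tendsto_upperbound) simp
  qed
  with p1 have norm1: "cmod (w p) = 1" by simp
  \<comment> \<open>Because \<open>cmod (w p) = 1\<close>, multiplying by \<open>cnj (w p)\<close>
    is dividing by \<open>w p\<close>, so \<open>D\<close> is the quotient p w'(p) / w(p).\<close>
  define D where "D = cnj (w p) * (p * deriv w p)"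
  \<comment> \<open>Each \<open>c\<close> with \<open>Re c < 0\<close> points into the disc: start
    at \<open>p\<close>, move along \<open>p * (1 + s * c)\<close> and compare the initial growth of
    both sides of the Schwarz bound, which agree at \<open>s = 0\<close>.\<close>
  have dir: "Re (D * c) \<le> Re c" if "Re c < 0" for c
  proof -
    have "((\<lambda>s::real. w (p * (1 + s * c))) has_vector_derivative deriv w p * (p * c)) (at 0)"
      using der
      by (intro has_vector_derivative_real_field DERIV_chain2[where f = w])
        (auto intro!: derivative_eq_intros)
    moreover have "((\<lambda>s::real. 1 + s * c) has_vector_derivative c) (at 0)"
      by (auto intro!: derivative_eq_intros has_vector_derivative_real_field)
    \<comment> \<open>For positive \<open>s\<close> below this limit the expansion of
      \<open>(cmod (1 + s * c))\<^sup>2\<close> falls below 1, so the Schwarz bound applies.\<close>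
    moreover have "cmod (w (p * (1 + s * c))) \<le> cmod (1 + s * c)"
      if "0 < s" "s < - 2 * Re c / (cmod c)\<^sup>2" for s :: real
    proof -
      have c0: "cmod c \<noteq> 0" using \<open>Re c < 0\<close> by auto
      have "(cmod (1 + s * c))\<^sup>2 = 1 + s * (2 * Re c + s * (cmod c)\<^sup>2)"
        unfolding cmod_power2 by (simp add: power2_eq_square algebra_simps)
      also have "\<dots> < 1"
      proof -
        have "2 * Re c + s * (cmod c)\<^sup>2 < 0" using that c0 by (simp add: field_simps)
        with \<open>0 < s\<close> show ?thesis using mult_pos_neg by fastforce
      qed
      finally have lt: "cmod (1 + s * c) < 1" by (simp add: power2_less_1_iff)
      have eq: "p * (1 + s * c) = r * (u * (1 + s * c))" by (simp add: u)
      show ?thesis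
        unfolding eq using schwarz[of "u * (1 + s * c)"] lt by (simp add: norm_mult u(1))
    qed
    moreover have "0 < - 2 * Re c / (cmod c)\<^sup>2" using that by (intro divide_pos_pos) auto
    ultimately have "w (p * (1 + (0::real) * c)) \<bullet> (deriv w p * (p * c)) \<le> (1 + (0::real) * c) \<bullet> c"
      by (intro inner_derivative_le_if_norm_le) (auto simp: norm1)
    then show ?thesis by (simp add: D_def inner_complex_def algebra_simps)
  qed
  have "Im D = 0"
  proof (rule ccontr)
    assume "Im D \<noteq> 0"
    \<comment> \<open>This choice gives \<open>Re (D * c) = 0\<close> but \<open>Re c = -1\<close>,
      against \<open>dir\<close>.\<close>
    define c where "c = Complex (-1) (- (Re D / Im D))"
    from dir[of c] show False using \<open>Im D \<noteq> 0\<close> by (simp add: c_def)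
  qed
  moreover have "Re D \<ge> 1" using dir[of "-1"] by simp
  moreover have "p * deriv w p = D * w p"
  proof -
    have "w p * cnj (w p) = 1" using norm1 by (simp add: complex_norm_square[symmetric])
    then have "p * deriv w p = (w p * cnj (w p)) * (p * deriv w p)" by simp
    then show ?thesis by (simp add: D_def mult_ac)
  qed
  ultimately show False
    using no[OF p1(3) norm1, of "Re D"] by (metis complex_is_Real_iff of_real_Re)
qed

section \<open>From starlikeness to a half-plane\<close>

lemma removable_divide:
  assumes "f holomorphic_on ball 0 1" "f 0 = 0"
  obtains g where "g holomorphic_on ball 0 1" "\<And>z. f z = z * g z" "g 0 = deriv f 0"
  using pole_lemma[OF assms(1), of 0] assms(2)
  by (intro that[of "\<lambda>z. if z = 0 then deriv f 0 else f z / z"]) (auto cong: if_cong)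

text \<open>
  The Schwarz lemma applies to $f^{-1}((1-s) f)$ for $0 < s < 1$; differentiate at $s = 0$.
\<close>

lemma starlike_Re_nonneg:
  assumes hol: "f holomorphic_on ball 0 1" and inj: "inj_on f (ball 0 1)" and f0: "f 0 = 0"
    and star: "starlike_wrt_origin (f ` ball 0 1)" and z: "z \<in> ball 0 1"
  shows "0 \<le> Re (cnj z * (f z / deriv f z))"
proof -
  obtain g where g: "g holomorphic_on f ` ball 0 1"
    "\<And>z. z \<in> ball 0 1 \<Longrightarrow> deriv f z * deriv g (f z) = 1" "\<And>z. z \<in> ball 0 1 \<Longrightarrow> g (f z) = z"
    using holomorphic_has_inverse[OF hol open_ball inj] by blast
  have op: "open (f ` ball 0 1)" using open_mapping_thm3[OF hol _ inj] by auto
  have der: "(g has_field_derivative 1 / deriv f z) (at (f z))"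
    using holomorphic_derivI[OF g(1) op, of "f z"] z g(2)[OF z]
    by (metis imageI divide_eq_eq mult.commute mult_zero_left zero_neq_one)
  have dom: "(1 - s) * f x \<in> f ` ball 0 1" if "x \<in> ball 0 1" "0 < s" "s < 1" for s :: real and x
  proof -
    have "(1 - s) *\<^sub>R f x \<in> closed_segment 0 (f x)"
      using that by (auto simp: in_segment intro!: exI[of _ "1 - s"])
    then show ?thesis using star that
      by (auto simp: starlike_wrt_origin_def scaleR_conv_of_real)
  qed
  have le: "cmod (g ((1 - s) * f z)) \<le> cmod z" if "0 < s" "s < 1" for s :: real
  proof (rule Schwarz_Lemma(1)[of "\<lambda>x. g ((1 - s) * f x)"])
    show "(\<lambda>x. g ((1 - s) * f x)) holomorphic_on ball 0 1"
      by (intro holomorphic_on_compose_gen[OF _ g(1), unfolded o_def] holomorphic_intros hol)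
        (use dom that in auto)
    show "g ((1 - s) * f 0) = 0" using f0 g(3)[of 0] by simp
    show "cmod (g ((1 - s) * f x)) < 1" if "cmod x < 1" for x
      using dom[of x s] that \<open>0 < s\<close> \<open>s < 1\<close> g(3) by auto
  qed (use z in auto)
  have der0: "((\<lambda>s::real. g ((1 - complex_of_real s) * f z)) has_vector_derivative (1 / deriv f z) * (- f z)) (at 0)"
    using der
    by (intro has_vector_derivative_real_field DERIV_chain2[where f = g])
      (auto intro!: derivative_eq_intros)
  have "g ((1 - complex_of_real 0) * f z) \<bullet> ((1 / deriv f z) * (- f z)) \<le> z \<bullet> 0"
    by (rule inner_derivative_le_if_norm_le[OF der0, where d = 1 and B = "\<lambda>_. z"])
      (use g(3)[OF z] le in auto)
  then have "0 \<le> z \<bullet> (f z / deriv f z)" using g(3)[OF z] by simp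
  moreover have "z \<bullet> v = Re (cnj z * v)" for v by (simp add: inner_complex_def)
  ultimately show ?thesis by metis
qed

text \<open>By the open mapping theorem a nonconstant \<open>P\<close> also takes the value
  \<open>P z - e/2\<close> for some \<open>e > 0\<close>, and the real part is nonnegative even
  there.\<close>

lemma Re_pos_if_Re_nonneg:
  assumes hol: "P holomorphic_on ball 0 1" and P0: "P 0 = 1"
    and nn: "\<And>z. z \<in> ball 0 1 \<Longrightarrow> 0 \<le> Re (P z)" and z: "z \<in> ball 0 1"
  shows "0 < Re (P z)"
proof (cases "P constant_on ball 0 1")
  case True
  then show ?thesis using P0 z by (metis centre_in_ball constant_on_def one_complex.sel(1) zero_less_one)
next
  case False
  then have "open (P ` ball 0 1)"
    using open_mapping_thm[OF hol open_ball connected_ball open_ball] by blast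
  then obtain e where e: "e > 0" "ball (P z) e \<subseteq> P ` ball 0 1"
    using z by (meson imageI open_contains_ball)
  then have "P z - of_real (e/2) \<in> P ` ball 0 1" by (intro subsetD[OF e(2)]) (auto simp: dist_norm)
  then obtain y where "y \<in> ball 0 1" "P z - of_real (e/2) = P y" by auto
  with nn[of y] have "0 \<le> Re (P z) - e/2" by (metis Re_complex_of_real minus_complex.sel(1))
  then show ?thesis using e(1) by simp
qed

lemma taylor_coeff_eqI: "f has_fps_expansion F \<Longrightarrow> taylor_coeff f k = fps_nth F k"
  by (simp add: taylor_coeff_def fps_expansion_eqI)

lemma taylor_coeff_deriv: "taylor_coeff f k = (deriv ^^ k) f 0 / fact k"
  by (simp add: taylor_coeff_def fps_expansion_def)

lemma has_fps_expansion_taylor: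
  "f holomorphic_on ball 0 1 \<Longrightarrow> f has_fps_expansion fps_expansion f 0"
  by (rule has_fps_expansion_fps_expansion[of "ball 0 1"]) auto

text \<open>Write 1/(1 - w) as 1/2 plus half the Cayley transform (1 + w)/(1 - w), whose real part
  has the sign of 1 - |w|^2.\<close>

lemma Re_inverse_one_minus:
  assumes "w \<noteq> (1::complex)"
  shows "cmod w < 1 \<Longrightarrow> Re (1 / (1 - w)) > 1 / 2"
    and "cmod w = 1 \<Longrightarrow> Re (1 / (1 - w)) = 1 / 2"
proof -
  have "1 / (1 - w) = (1 + w) / (1 - w) / 2 + 1 / 2"
    using assms by (simp add: field_simps)
  moreover have "Re (x / 2 + 1 / 2) = Re x / 2 + 1 / 2" for x by simp
  ultimately have eq: "Re (1 / (1 - w)) = Re ((1 + w) / (1 - w)) / 2 + 1 / 2" by metis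
  have num: "Re ((1 + w) * cnj (1 - w)) = 1 - (cmod w)\<^sup>2"
    unfolding cmod_power2 by (simp add: power2_eq_square algebra_simps)
  show "Re (1 / (1 - w)) > 1 / 2" if "cmod w < 1"
  proof -
    have "(cmod w)\<^sup>2 < 1" using that by (simp add: power_less_one_iff)
    then have "Re ((1 + w) / (1 - w)) > 0" unfolding Re_complex_div_gt_0 num by simp
    then show ?thesis unfolding eq by simp
  qed
  show "Re (1 / (1 - w)) = 1 / 2" if "cmod w = 1"
  proof -
    have "Re ((1 + w) / (1 - w)) = 0" unfolding Re_complex_div_eq_0 num using that by simp
    then show ?thesis unfolding eq by simp
  qed
qed

text \<open>\<open>F\<close> is f(z)/z, \<open>g\<close> its primitive vanishing at 0, and
  \<open>h\<close> is g(z)/z. The identities z F' = f' - F and z h' = F - h turn a contact in Jack's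
  lemma into an algebraic relation that violates the half-plane bound already known.\<close>

lemma starlike_half_plane:
  assumes f: "f \<in> class_S_star"
  obtains h where "h holomorphic_on ball 0 1" "h 0 = 1" "\<And>z. z \<in> ball 0 1 \<Longrightarrow> 1 / 2 < Re (h z)"
    "\<And>k. taylor_coeff f (Suc k) = of_nat (Suc k) * taylor_coeff h k"
proof -
  have hol: "f holomorphic_on ball 0 1" and inj: "inj_on f (ball 0 1)"
    and star: "starlike_wrt_origin (f ` ball 0 1)" and f0: "f 0 = 0" and f1: "deriv f 0 = 1"
    using f by (auto simp: class_S_star_def class_S_def taylor_coeff_deriv)
  obtain F where F: "F holomorphic_on ball 0 1" "\<And>z. f z = z * F z" "F 0 = 1"
    using removable_divide[OF hol f0] f1 by metis
  have F_nz: "F z \<noteq> 0" if "z \<in> ball 0 1" for z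
  proof
    assume "F z = 0"
    then have "f z = f 0" by (simp add: F(2))
    with inj that have "z = 0" by (meson centre_in_ball inj_on_eq_iff zero_less_one)
    with \<open>F z = 0\<close> F(3) show False by simp
  qed
  obtain G where G: "\<And>z. z \<in> ball 0 1 \<Longrightarrow> (G has_field_derivative F z) (at z)"
    using holomorphic_convex_primitive'[OF convex_ball open_ball F(1)]
    by (metis at_within_open open_ball)
  define g where "g z = G z - G 0" for z
  have g: "(g has_field_derivative F z) (at z)" if "z \<in> ball 0 1" for z
    unfolding g_def using G[OF that] by (auto intro!: derivative_eq_intros)
  have g_hol: "g holomorphic_on ball 0 1"
    using g by (meson holomorphic_onI has_field_derivative_at_within field_differentiable_def)
  obtain h where h: "h holomorphic_on ball 0 1" "\<And>z. g z = z * h z" "h 0 = 1"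
    using removable_divide[OF g_hol] g[of 0] F(3) by (auto simp: DERIV_imp_deriv g_def)
  have dF: "(F has_field_derivative deriv F z) (at z)"
    and dh: "(h has_field_derivative deriv h z) (at z)"
    if "z \<in> ball 0 1" for z
    using that F(1) h(1) by (auto intro!: holomorphic_derivI)
  have zdF: "z * deriv F z = deriv f z - F z" if "z \<in> ball 0 1" for z
  proof -
    have "f = (\<lambda>z. z * F z)" using F(2) by auto
    then have "(f has_field_derivative F z + z * deriv F z) (at z)"
      using dF[OF that] by (auto intro!: derivative_eq_intros)
    then show ?thesis by (simp add: DERIV_imp_deriv)
  qed
  have zdh: "z * deriv h z = F z - h z" if "z \<in> ball 0 1" for z
  proof -
    have "g = (\<lambda>z. z * h z)" using h(2) by auto
    then have "(g has_field_derivative h z + z * deriv h z) (at z)"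
      using dh[OF that] by (auto intro!: derivative_eq_intros)
    then show ?thesis using DERIV_unique[OF g[OF that]] by simp
  qed
  define P where "P z = deriv f z / F z" for z
  have P_pos: "0 < Re (P z)" if z: "z \<in> ball 0 1" for z
  proof (rule Re_pos_if_Re_nonneg[OF _ _ _ z])
    show "P holomorphic_on ball 0 1"
      unfolding P_def using F_nz hol F(1) by (intro holomorphic_intros) auto
    show "P 0 = 1" by (simp add: P_def F(3) f1)
    show "0 \<le> Re (P z)" if z: "z \<in> ball 0 1" for z
    \<comment> \<open>Off 0 the starlikeness inequality carries the positive factor |z|^2, and
      passing from \<open>F z / deriv f z\<close> to its reciprocal \<open>P z\<close> keeps the
      sign of the real part.\<close>
    proof (cases "z = 0")
      case False
      have "0 \<le> Re (cnj z * (f z / deriv f z))"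
        using starlike_Re_nonneg[OF hol inj f0 star z] .
      also have "cnj z * (f z / deriv f z) = of_real ((cmod z)\<^sup>2) * (F z / deriv f z)"
        unfolding F(2) complex_norm_square by (simp add: mult_ac)
      also have "Re \<dots> = (cmod z)\<^sup>2 * Re (F z / deriv f z)"
        by (simp only: times_complex.sel Re_complex_of_real Im_complex_of_real)
      finally have "0 \<le> Re (F z / deriv f z)" using False
        by (simp add: zero_le_mult_iff)
      then have "0 \<le> Re (F z * cnj (deriv f z))" by (simp add: Re_complex_div_ge_0)
      moreover have "Re (F z * cnj (deriv f z)) = Re (deriv f z * cnj (F z))" by (simp add: mult.commute)
      ultimately show ?thesis by (simp only: P_def Re_complex_div_ge_0)
    qed (simp add: P_def F(3) f1)
  qed
  \<comment> \<open>Here F/h = 1/(1 - v), so |v| < 1 means Re (F/h) > 1/2. A contact z v' = k v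
    gives P = (1 + k)/(1 - v) - k, whose real part (1 - k)/2 is not positive.\<close>
  define v where "v z = 1 - h z / F z" for z
  have v1: "cmod (v z) < 1" if "z \<in> ball 0 1" for z
  proof (rule norm_lt_one_if_no_radial_contact[OF _ _ _ that])
    show "v holomorphic_on ball 0 1"
      unfolding v_def using F_nz F(1) h(1) by (intro holomorphic_intros) auto
    show "v 0 = 0" by (simp add: v_def F(3) h(3))
    fix z and k :: real assume z: "z \<in> ball 0 1" and 1: "cmod (v z) = 1" and k: "1 \<le> k"
    show "z * deriv v z \<noteq> k * v z"
    proof
      assume *: "z * deriv v z = k * v z"
      have "(v has_field_derivative - ((deriv h z * F z - h z * deriv F z) / (F z * F z))) (at z)"
        unfolding v_def using F_nz[OF z] dF[OF z] dh[OF z]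
        by (auto intro!: derivative_eq_intros)
      then have "z * deriv v z = - ((z * deriv h z) * F z - h z * (z * deriv F z)) / (F z * F z)"
        using F_nz[OF z] by (simp add: DERIV_imp_deriv field_simps)
      also have "\<dots> = (1 - v z) * P z - 1"
        unfolding v_def P_def zdh[OF z] zdF[OF z] using F_nz[OF z] by (simp add: field_simps)
      finally have eq: "(1 - v z) * P z = 1 + k * v z" using * by simp
      have "v z \<noteq> 1"
      proof
        assume "v z = 1"
        with eq have "complex_of_real (1 + k) = 0" by simp
        then have "1 + k = 0" by (simp only: of_real_eq_0_iff)
        with k show False by simp
      qed
      define x where "x = 1 / (1 - v z)"
      have "P z = of_real (1 + k) * x - of_real k"
        using \<open>v z \<noteq> 1\<close> eq by (simp add: x_def field_simps)
      then have "Re (P z) = (1 + k) * Re x - k" by simp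
      moreover have "Re x = 1 / 2"
        using Re_inverse_one_minus(2)[OF \<open>v z \<noteq> 1\<close> 1] by (simp only: x_def)
      ultimately show False using k P_pos[OF z] by simp
    qed
  qed
  have h_nz: "h z \<noteq> 0" if "z \<in> ball 0 1" for z
    using v1[OF that] by (auto simp: v_def)
  \<comment> \<open>Here h = 1/(1 - w). A contact z w' = k w gives F/h = k/(1 - w) - (k - 1), whose
    real part 1 - k/2 is at most 1/2, against the bound obtained from \<open>v\<close>.\<close>
  define w where "w z = 1 - 1 / h z" for z
  have w1: "cmod (w z) < 1" if "z \<in> ball 0 1" for z
  proof (rule norm_lt_one_if_no_radial_contact[OF _ _ _ that])
    show "w holomorphic_on ball 0 1"
      unfolding w_def using h_nz h(1) by (intro holomorphic_intros) auto
    show "w 0 = 0" by (simp add: w_def h(3))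
    fix z and k :: real assume z: "z \<in> ball 0 1" and 1: "cmod (w z) = 1" and k: "1 \<le> k"
    show "z * deriv w z \<noteq> k * w z"
    proof
      assume *: "z * deriv w z = k * w z"
      have "(w has_field_derivative deriv h z / (h z * h z)) (at z)"
        unfolding w_def using h_nz[OF z] dh[OF z]
        by (auto intro!: derivative_eq_intros)
      then have "z * deriv w z = (z * deriv h z) / (h z * h z)"
        by (simp add: DERIV_imp_deriv)
      also have "\<dots> = (1 - w z) * (F z / h z - 1)"
        unfolding w_def zdh[OF z] using h_nz[OF z] by (simp add: field_simps)
      finally have eq: "(1 - w z) * (F z / h z - 1) = k * w z" using * by simp
      have "w z \<noteq> 1" using h_nz[OF z] by (simp add: w_def)
      define x y where "x = 1 / (1 - w z)" and "y = F z / h z"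
      have "(1 - w z) * (y - 1) = of_real k * w z" using eq by (simp only: y_def)
      then have "y = of_real k * x - of_real (k - 1)"
        using \<open>w z \<noteq> 1\<close> by (simp add: x_def field_simps)
      then have "Re y = k * Re x - (k - 1)" by simp
      moreover have "y = 1 / (1 - v z)" by (simp add: v_def y_def)
      then have "Re y > 1 / 2"
        using Re_inverse_one_minus(1)[of "v z"] v1[OF z] by (cases "v z = 1") simp_all
      moreover have "Re x = 1 / 2"
        using Re_inverse_one_minus(2)[OF \<open>w z \<noteq> 1\<close> 1] by (simp only: x_def)
      ultimately show False using k by simp
    qed
  qed
  have "1 / 2 < Re (h z)" if "z \<in> ball 0 1" for z
  proof -
    have "h z = 1 / (1 - w z)" by (simp add: w_def)
    then show ?thesis using Re_inverse_one_minus(1)[of "w z"] w1[OF that] by (cases "w z = 1") simp_all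
  qed
  \<comment> \<open>Compare power series in f = z (z h)', which holds near 0 because F = g' and g =
    z h.\<close>
  moreover have "taylor_coeff f (Suc k) = of_nat (Suc k) * taylor_coeff h k" for k
  proof -
    define H where "H = fps_expansion h 0"
    have H: "h has_fps_expansion H" unfolding H_def using h(1) by (rule has_fps_expansion_taylor)
    have gH: "g has_fps_expansion fps_X * H"
    proof -
      have "g = (\<lambda>z. z * h z)" using h(2) by auto
      then show ?thesis using H by (auto intro!: fps_expansion_intros)
    qed
    have "\<forall>\<^sub>F z in nhds 0. deriv g z = F z"
      by (rule eventually_mono[OF eventually_nhds_in_open[of "ball 0 1" 0]])
        (auto intro!: DERIV_imp_deriv g)
    then have F': "F has_fps_expansion fps_deriv (fps_X * H)"
      using has_fps_expansion_deriv[OF gH] has_fps_expansion_cong[OF _ refl] by blast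
    have "f has_fps_expansion fps_X * fps_deriv (fps_X * H)"
    proof -
      have "f = (\<lambda>z. z * F z)" using F(2) by auto
      then show ?thesis using F' by (auto intro!: fps_expansion_intros)
    qed
    from taylor_coeff_eqI[OF this] taylor_coeff_eqI[OF H] show ?thesis by (simp add: algebra_simps)
  qed
  ultimately show ?thesis using that h(1,3) by blast
qed

section \<open>Fourier coefficients on circles and a positive quadratic form\<close>

lemma has_integral_circle_taylor:
  assumes hol: "h holomorphic_on ball 0 1" and r: "0 < r" "r < 1"
  shows "((\<lambda>t. h (of_real r * cis t) * cis (- (real k * t))) has_integral
           2 * of_real pi * taylor_coeff h k * of_real r ^ k) {0..2 * pi}"
proof -
  have sub: "cball 0 r \<subseteq> ball (0::complex) 1" using r by auto
  have "((\<lambda>u. h u / (u - 0) ^ Suc k) has_contour_integral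
      2 * pi * \<i> / fact k * (deriv ^^ k) h 0) (circlepath 0 r)"
    using hol r sub
    by (intro Cauchy_has_contour_integral_higher_derivative_circlepath)
      (auto intro!: holomorphic_on_imp_continuous_on elim!: holomorphic_on_subset)
  then have "((\<lambda>t. h (of_real r * cis t) / (of_real r * cis t) ^ Suc k * r * \<i> * cis t) has_integral
      2 * pi * \<i> * taylor_coeff h k) {0..2 * pi}"
    unfolding circlepath_def by (subst (asm) has_contour_integral_part_circlepath_iff)
      (auto simp: taylor_coeff_deriv)
  from has_integral_mult_right[OF this, of "of_real r ^ k / \<i>"] have "((\<lambda>t. of_real r ^ k / \<i> *
      (h (of_real r * cis t) / (of_real r * cis t) ^ Suc k * r * \<i> * cis t)) has_integral
      2 * of_real pi * taylor_coeff h k * of_real r ^ k) {0..2 * pi}"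
    by (rule has_integral_eq_rhs) (simp add: field_simps)
  then show ?thesis
  proof (rule has_integral_eq[rotated])
    fix t
    have "cis (- (real k * t)) = 1 / cis t ^ k"
      by (simp add: Complex.DeMoivre cis_inverse flip: inverse_eq_divide)
    then show "of_real r ^ k / \<i> * (h (of_real r * cis t) / (of_real r * cis t) ^ Suc k * r * \<i> * cis t)
        = h (of_real r * cis t) * cis (- (real k * t))"
      using r by (simp add: field_simps)
  qed
qed

text \<open>Up to a constant this is the contour integral of \<open>h u * u ^ (k - 1)\<close>, which
  vanishes by Cauchy's theorem; \<open>k \<ge> 1\<close> makes the exponent a genuine
  \<open>k - 1\<close>.\<close>

lemma has_integral_circle_zero:
  assumes hol: "h holomorphic_on ball 0 1" and r: "0 < r" "r < 1" and k: "k \<ge> 1"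
  shows "((\<lambda>t. h (of_real r * cis t) * cis (real k * t)) has_integral 0) {0..2 * pi}"
proof -
  have "((\<lambda>u. h u * u ^ (k - 1)) has_contour_integral 0) (circlepath 0 r)"
    using r by (intro Cauchy_theorem_disc_simple[of _ 0 1] holomorphic_intros hol) auto
  then have "((\<lambda>t. h (of_real r * cis t) * (of_real r * cis t) ^ (k - 1) * r * \<i> * cis t) has_integral 0) {0..2 * pi}"
    unfolding circlepath_def by (subst (asm) has_contour_integral_part_circlepath_iff) auto
  from has_integral_mult_right[OF this, of "1 / (\<i> * of_real r ^ k)"] show ?thesis
  proof (rule has_integral_eq_rhs[OF has_integral_eq, rotated])
    fix t
    have "cis (real k * t) = cis t ^ (k - 1) * cis t"
      using k by (metis Complex.DeMoivre power_minus_mult le_eq_less_or_eq less_one not_le gr0I)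
    moreover have "complex_of_real r ^ k = of_real r ^ (k - 1) * of_real r"
      using k by (simp flip: power_Suc2)
    ultimately show "1 / (\<i> * of_real r ^ k) * (h (of_real r * cis t) * (of_real r * cis t) ^ (k - 1) * r * \<i> * cis t)
        = h (of_real r * cis t) * cis (real k * t)"
      using r by (simp add: field_simps)
  qed simp
qed

text \<open>Average h with its conjugate: the conjugate part integrates to 0 for
  \<open>k \<ge> 1\<close>, so half of the Taylor integral remains, whence the factor pi instead of
  2 pi.\<close>

lemma has_integral_circle_Re:
  assumes hol: "h holomorphic_on ball 0 1" and r: "0 < r" "r < 1" and k: "k \<ge> 1"
  shows "((\<lambda>t. of_real (Re (h (of_real r * cis t))) * cis (- (real k * t))) has_integral
           of_real pi * taylor_coeff h k * of_real r ^ k) {0..2 * pi}"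
proof -
  have "((\<lambda>t. cnj (h (of_real r * cis t) * cis (real k * t))) has_integral cnj 0) {0..2 * pi}"
    using has_integral_circle_zero[OF assms] has_integral_cnj by (metis (no_types, lifting) comp_apply has_integral_cong)
  from has_integral_mult_right[OF has_integral_add[OF has_integral_circle_taylor[OF hol r, of k] this], of "1/2"]
  show ?thesis
  proof (rule has_integral_eq_rhs[OF has_integral_eq, rotated])
    fix t
    have "x * y + cnj (x * cnj y) = 2 * (of_real (Re x) * y)" for x y
      by (simp add: complex_add_cnj flip: distrib_right)
    from this[of "h (of_real r * cis t)" "cis (- (real k * t))"]
    show "1 / 2 * (h (of_real r * cis t) * cis (- (real k * t)) + cnj (h (of_real r * cis t) * cis (real k * t)))
        = of_real (Re (h (of_real r * cis t))) * cis (- (real k * t))"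
      by (simp add: cis_cnj)
  qed simp
qed

lemma cmod_add3_square:
  "(cmod (x + y + w))\<^sup>2 = (cmod x)\<^sup>2 + (cmod y)\<^sup>2 + (cmod w)\<^sup>2
     + 2 * Re (cnj x * y + x * cnj w + y * cnj w)"
  unfolding cmod_power2 by (simp add: power2_eq_square algebra_simps)

lemma taylor_coeff_lincomb:
  assumes "f holomorphic_on ball 0 1" "g holomorphic_on ball 0 1"
  shows "taylor_coeff (\<lambda>z. c * f z + d * g z) k = c * taylor_coeff f k + d * taylor_coeff g k"
proof -
  have "(\<lambda>z. c * f z + d * g z) has_fps_expansion
      fps_const c * fps_expansion f 0 + fps_const d * fps_expansion g 0"
    by (intro fps_expansion_intros has_fps_expansion_taylor assms)
  then show ?thesis by (simp add: taylor_coeff_eqI) (simp add: taylor_coeff_def)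
qed

text \<open>With H = 2h - 1, the function Re H / (2 pi) on the circle of radius r < 1 is a
  probability density whose k-th Fourier coefficient is c_k r^k, where c_k is the coefficient of h.
  Integrating a squared modulus against it gives the inequality at radius r, and r tends to
  1.\<close>

lemma half_plane_positive_definite:
  assumes hol: "h holomorphic_on ball 0 1" and h0: "h 0 = 1"
    and half: "\<And>z. z \<in> ball 0 1 \<Longrightarrow> 1 / 2 < Re (h z)"
    and i: "i \<ge> 1" and j: "j \<ge> 1" and b: "cmod b = 1"
  shows "0 \<le> (cmod a)\<^sup>2 + 2 + 2 * Re (cnj a * b * taylor_coeff h i + a * taylor_coeff h j
           + b * taylor_coeff h (i + j))"
proof -
  define H where "H z = 2 * h z - 1" for z
  define S where "S r = cnj a * b * (taylor_coeff h i * of_real r ^ i) + a * (taylor_coeff h j * of_real r ^ j)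
      + b * (taylor_coeff h (i + j) * of_real r ^ (i + j))" for r
  have H_hol: "H holomorphic_on ball 0 1" unfolding H_def by (intro holomorphic_intros hol)
  have H_coeff: "taylor_coeff H k = 2 * taylor_coeff h k - (if k = 0 then 1 else 0)" for k
  proof -
    have "H has_fps_expansion fps_const 2 * fps_expansion h 0 - 1"
      unfolding H_def by (intro fps_expansion_intros has_fps_expansion_taylor hol)
    then show ?thesis by (simp add: taylor_coeff_eqI) (simp add: taylor_coeff_def)
  qed
  have radius: "0 \<le> (cmod a)\<^sup>2 + 2 + 2 * Re (S r)" if r: "0 < r" "r < 1" for r
  proof -
    define p where "p t = Re (H (of_real r * cis t))" for t
    define u where "u k t = cis (- (real k * t))" for k t
    have p_nonneg: "0 \<le> p t" for t
      using half[of "of_real r * cis t"] r by (simp add: p_def H_def norm_mult)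
    have moment: "((\<lambda>t. of_real (p t) * u k t) has_integral 2 * of_real pi * (taylor_coeff h k * of_real r ^ k)) {0..2 * pi}"
      if "k \<ge> 1" for k
      using has_integral_circle_Re[OF H_hol r that] that by (simp add: H_coeff p_def u_def mult_ac)
    have mass: "(p has_integral 2 * pi) {0..2 * pi}"
      using has_integral_linear[OF has_integral_circle_taylor[OF H_hol r, of 0] bounded_linear_Re] h0
      by (simp add: p_def[abs_def] o_def taylor_coeff_deriv H_def)
    have "((\<lambda>t. cnj a * b * (of_real (p t) * u i t) + a * (of_real (p t) * u j t) + b * (of_real (p t) * u (i + j) t))
        has_integral cnj a * b * (2 * of_real pi * (taylor_coeff h i * of_real r ^ i))
          + a * (2 * of_real pi * (taylor_coeff h j * of_real r ^ j))
          + b * (2 * of_real pi * (taylor_coeff h (i + j) * of_real r ^ (i + j)))) {0..2 * pi}"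
      using i j by (intro has_integral_add has_integral_mult_right moment) auto
    then have "((\<lambda>t. of_real (p t) * (cnj a * b * u i t + a * u j t + b * u (i + j) t))
        has_integral of_real (2 * pi) * S r) {0..2 * pi}"
      by (simp add: S_def algebra_simps)
    from has_integral_linear[OF this bounded_linear_Re]
    have "((\<lambda>t. p t * Re (cnj a * b * u i t + a * u j t + b * u (i + j) t))
        has_integral 2 * pi * Re (S r)) {0..2 * pi}"
      unfolding o_def times_complex.sel by simp
    from has_integral_add[OF has_integral_mult_right[OF mass, of "(cmod a)\<^sup>2 + 2"]
        has_integral_mult_right[OF this, of 2]]
    have "0 \<le> ((cmod a)\<^sup>2 + 2) * (2 * pi) + 2 * (2 * pi * Re (S r))"
    proof (rule has_integral_nonneg)
      fix t
      have "u (i + j) t = u i t * u j t" by (simp add: u_def cis_mult algebra_simps)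
      \<comment> \<open>Multiplicativity of \<open>u\<close> in its index makes the cross terms of
        the square exactly the three required ones; \<open>cmod b = 1\<close> and the unimodular
        \<open>u\<close> supply the constant 2.\<close>
      then have "(cmod a)\<^sup>2 + 2 + 2 * Re (cnj a * b * u i t + a * u j t + b * u (i + j) t)
          = (cmod (a + b * u i t + cnj (u j t)))\<^sup>2"
        unfolding cmod_add3_square by (simp add: u_def norm_mult b mult.assoc)
      then have "0 \<le> (cmod a)\<^sup>2 + 2 + 2 * Re (cnj a * b * u i t + a * u j t + b * u (i + j) t)"
        by simp
      from mult_nonneg_nonneg[OF p_nonneg[of t] this]
      show "0 \<le> ((cmod a)\<^sup>2 + 2) * p t + 2 * (p t * Re (cnj a * b * u i t + a * u j t + b * u (i + j) t))"
        by (simp only: distrib_left mult_ac)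
    qed
    also have "\<dots> = 2 * pi * ((cmod a)\<^sup>2 + 2 + 2 * Re (S r))" by (simp add: algebra_simps)
    finally show ?thesis using pi_gt_zero by (simp add: zero_le_mult_iff)
  qed
  have "((\<lambda>r. (cmod a)\<^sup>2 + 2 + 2 * Re (S r)) \<longlongrightarrow> (cmod a)\<^sup>2 + 2 + 2 * Re (S 1)) (at_left 1)"
    unfolding S_def by (intro tendsto_intros)
  moreover have "\<forall>\<^sub>F r in at_left 1. 0 \<le> (cmod a)\<^sup>2 + 2 + 2 * Re (S r)"
    unfolding eventually_at_left_field using radius by (intro exI[of _ 0]) auto
  ultimately have "0 \<le> (cmod a)\<^sup>2 + 2 + 2 * Re (S 1)" by (rule tendsto_lowerbound) simp
  then show ?thesis by (simp add: S_def mult_ac)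
qed

section \<open>Positivity on the closed convex hull\<close>

text \<open>The shift by one turns the indices m, n, m + n - 1 of the theorem into i, j, i +
  j.\<close>

definition moment :: "(complex \<Rightarrow> complex) \<Rightarrow> nat \<Rightarrow> complex" where
  "moment f k = taylor_coeff f (Suc k) / of_nat (Suc k)"

text \<open>
  If the moments are those of a probability measure on the circle, this is the integral of
  $|a + b x^i + \bar x^j|^2$ for $|b| = 1$.
\<close>

definition pos_form :: "complex \<Rightarrow> complex \<Rightarrow> nat \<Rightarrow> nat \<Rightarrow> (complex \<Rightarrow> complex) \<Rightarrow> real" where
  "pos_form a b i j f =
     (cmod a)\<^sup>2 + 2 + 2 * Re (cnj a * b * moment f i + a * moment f j + b * moment f (i + j))"

text \<open>An intersection of half-spaces, one for each pair \<open>a\<close>, \<open>b\<close>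
  with \<open>cmod b = 1\<close>, so convexity and closedness can be checked on a single affine
  condition.\<close>

definition pos_class :: "nat \<Rightarrow> nat \<Rightarrow> (complex \<Rightarrow> complex) set" where
  "pos_class i j = {f. f holomorphic_on ball 0 1 \<and> (\<forall>a b. cmod b = 1 \<longrightarrow> 0 \<le> pos_form a b i j f)}"

lemma class_S_star_subset_pos_class:
  assumes "i \<ge> 1" "j \<ge> 1"
  shows "class_S_star \<subseteq> pos_class i j"
proof
  fix f assume f: "f \<in> class_S_star"
  obtain h where h: "h holomorphic_on ball 0 1" "h 0 = 1" "\<And>z. z \<in> ball 0 1 \<Longrightarrow> 1 / 2 < Re (h z)"
    "\<And>k. taylor_coeff f (Suc k) = of_nat (Suc k) * taylor_coeff h k"
    using starlike_half_plane[OF f] by metis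
  have "moment f k = taylor_coeff h k" for k
    unfolding moment_def h(4) by (simp del: of_nat_Suc)
  then have "0 \<le> pos_form a b i j f" if "cmod b = 1" for a b
    using half_plane_positive_definite[OF h(1-3) assms that, of a] by (simp add: pos_form_def)
  then show "f \<in> pos_class i j"
    using f by (auto simp: pos_class_def class_S_star_def class_S_def)
qed

lemma convex_funs_pos_class: "convex_funs (pos_class i j)"
  unfolding convex_funs_def
proof (intro ballI allI impI)
  fix f g and u v :: real
  assume f: "f \<in> pos_class i j" and g: "g \<in> pos_class i j" and uv: "0 \<le> u" "0 \<le> v" "u + v = 1"
  let ?k = "\<lambda>z. of_real u * f z + of_real v * g z"
  have hol: "f holomorphic_on ball 0 1" "g holomorphic_on ball 0 1"
    using f g by (auto simp: pos_class_def)
  have mom: "moment ?k n = of_real u * moment f n + of_real v * moment g n" for n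
    unfolding moment_def taylor_coeff_lincomb[OF hol] by (simp add: add_divide_distrib)
  have "pos_form a b i j ?k = u * pos_form a b i j f + v * pos_form a b i j g" for a b
  proof -
    have v: "v = 1 - u" using uv(3) by simp
    \<comment> \<open>Eliminating \<open>v\<close> lets the constant term
      \<open>(cmod a)\<^sup>2 + 2\<close> split according to the weights; the rest is
      linear.\<close>
    show ?thesis unfolding pos_form_def mom unfolding v by (simp add: algebra_simps)
  qed
  then show "?k \<in> pos_class i j"
    using f g uv hol by (auto simp: pos_class_def intro!: holomorphic_intros)
qed

section \<open>Closedness in the topology of compact convergence\<close>

lemma openin_compact_nbhd:
  assumes "f holomorphic_on ball 0 1" "compact K" "K \<subseteq> ball 0 1" "0 < e"
  shows "openin compact_convergence_topology (compact_nbhd f K e)"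
  unfolding compact_convergence_topology_def
  using assms by (intro topology_generated_by_Basis) auto

lemma topspace_compact_convergence:
  "topspace compact_convergence_topology = {f. f holomorphic_on ball 0 1}"
proof -
  have "f \<in> topspace compact_convergence_topology" if "f holomorphic_on ball 0 1" for f
  proof -
    \<comment> \<open>Over the empty compact set the distance condition is vacuous, so this open set
      contains every function holomorphic on the disc.\<close>
    have "f \<in> compact_nbhd f {} 1" using that by (simp add: compact_nbhd_def)
    with openin_subset[OF openin_compact_nbhd[OF that, of "{}" 1]] show ?thesis by auto
  qed
  moreover have "f holomorphic_on ball 0 1" if "f \<in> topspace compact_convergence_topology" for f
    using that unfolding compact_convergence_topology_def topology_generated_by_topspace
    by (auto simp: compact_nbhd_def)
  ultimately show ?thesis by blast
qed

text \<open>Cauchy's inequality on the circle of radius 1/2 makes each moment continuous; dividing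
  by \<open>Suc k\<close> only shrinks the difference.\<close>

lemma moment_diff_le:
  assumes hol: "f holomorphic_on ball 0 1" "g holomorphic_on ball 0 1"
    and le: "\<And>z. z \<in> cball 0 (1/2) \<Longrightarrow> cmod (g z - f z) \<le> e"
  shows "cmod (moment g k - moment f k) \<le> e * 2 ^ Suc k"
proof -
  let ?d = "\<lambda>z. 1 * g z + (-1) * f z"
  have d_hol: "?d holomorphic_on ball 0 1" by (intro holomorphic_intros hol)
  have "cmod ((deriv ^^ Suc k) ?d 0) \<le> fact (Suc k) * e / (1 / 2) ^ Suc k"
  proof (rule Cauchy_inequality)
    show "?d holomorphic_on ball 0 (1/2)" using d_hol by (rule holomorphic_on_subset) auto
    show "continuous_on (cball 0 (1/2)) ?d"
      by (rule holomorphic_on_imp_continuous_on, rule holomorphic_on_subset[OF d_hol]) auto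
    show "cmod (?d z) \<le> e" if "cmod (0 - z) = 1/2" for z using le[of z] that by simp
  qed simp
  then have "cmod (taylor_coeff ?d (Suc k)) \<le> e * 2 ^ Suc k"
    by (simp add: taylor_coeff_deriv norm_divide field_simps del: power_Suc fact_Suc)
  moreover have "moment g k - moment f k = taylor_coeff ?d (Suc k) / of_nat (Suc k)"
    unfolding moment_def taylor_coeff_lincomb[OF hol(2,1)] by (simp add: diff_divide_distrib)
  then have "cmod (moment g k - moment f k) = cmod (taylor_coeff ?d (Suc k)) / real (Suc k)"
    by (simp only: norm_divide norm_of_nat)
  moreover have "x / real (Suc k) \<le> x" if "0 \<le> x" for x
    using that by (simp add: divide_le_eq mult_le_cancel_left1 del: of_nat_Suc)
  then have "cmod (taylor_coeff ?d (Suc k)) / real (Suc k) \<le> cmod (taylor_coeff ?d (Suc k))"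
    by simp
  ultimately show ?thesis by linarith
qed

lemma closedin_pos_class: "closedin compact_convergence_topology (pos_class i j)"
  unfolding closedin_def
proof
  show "pos_class i j \<subseteq> topspace compact_convergence_topology"
    by (auto simp: pos_class_def topspace_compact_convergence)
  show "openin compact_convergence_topology (topspace compact_convergence_topology - pos_class i j)"
  proof (subst openin_subopen, intro ballI)
    fix f assume "f \<in> topspace compact_convergence_topology - pos_class i j"
    then obtain a b where f: "f holomorphic_on ball 0 1" and b: "cmod b = 1" and neg: "pos_form a b i j f < 0"
      by (auto simp: pos_class_def topspace_compact_convergence not_le)
    \<comment> \<open>\<open>C\<close> is a Lipschitz constant of \<open>pos_form a b i j\<close>
      for the uniform distance on the closed disc of radius 1/2. Within distance \<open>e/2\<close>
      the form moves by at most half of its distance from 0, so it stays negative.\<close>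
    define C where "C = 2 * (cmod a * 2 ^ Suc i + cmod a * 2 ^ Suc j + 2 ^ Suc (i + j))"
    have "C > 0" unfolding C_def by (intro mult_pos_pos add_nonneg_pos) auto
    define e where "e = - pos_form a b i j f / C"
    have "e > 0" using neg \<open>C > 0\<close> by (simp add: e_def divide_neg_pos)
    have sub: "cball 0 (1/2) \<subseteq> ball (0::complex) 1" by auto
    have "pos_form a b i j g < 0" if g: "g \<in> compact_nbhd f (cball 0 (1/2)) (e/2)" for g
    proof -
      have diff: "cmod (moment g k - moment f k) \<le> e/2 * 2 ^ Suc k" for k
        using g f by (intro moment_diff_le) (auto simp: compact_nbhd_def less_imp_le)
      have "pos_form a b i j g - pos_form a b i j f = 2 * Re (cnj a * b * (moment g i - moment f i)
          + a * (moment g j - moment f j) + b * (moment g (i + j) - moment f (i + j)))"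
        by (simp add: pos_form_def algebra_simps)
      also have "\<dots> \<le> 2 * cmod (cnj a * b * (moment g i - moment f i)
          + a * (moment g j - moment f j) + b * (moment g (i + j) - moment f (i + j)))"
        by (intro mult_left_mono complex_Re_le_cmod) simp
      also have "\<dots> \<le> 2 * (cmod a * (e/2 * 2 ^ Suc i) + cmod a * (e/2 * 2 ^ Suc j) + (e/2 * 2 ^ Suc (i + j)))"
      proof (intro mult_left_mono norm_triangle_le add_mono)
        show "cmod (cnj a * b * (moment g i - moment f i)) \<le> cmod a * (e/2 * 2 ^ Suc i)"
          "cmod (a * (moment g j - moment f j)) \<le> cmod a * (e/2 * 2 ^ Suc j)"
          by (simp_all only: norm_mult b complex_mod_cnj mult_1_right mult_left_mono[OF diff] norm_ge_zero)
        show "cmod (b * (moment g (i + j) - moment f (i + j))) \<le> e/2 * 2 ^ Suc (i + j)"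
          by (simp only: norm_mult b mult_1 diff)
      qed simp
      also have "\<dots> = e / 2 * C" by (simp add: C_def algebra_simps)
      also have "\<dots> < - pos_form a b i j f" using neg \<open>C > 0\<close> by (simp add: e_def)
      finally show ?thesis by simp
    qed
    then have "compact_nbhd f (cball 0 (1/2)) (e/2) \<subseteq> topspace compact_convergence_topology - pos_class i j"
      using b by (force simp: pos_class_def topspace_compact_convergence compact_nbhd_def simp flip: not_le)
    moreover have "f \<in> compact_nbhd f (cball 0 (1/2)) (e/2)" using f \<open>e > 0\<close> by (simp add: compact_nbhd_def)
    ultimately show "\<exists>T. openin compact_convergence_topology T \<and> f \<in> T
        \<and> T \<subseteq> topspace compact_convergence_topology - pos_class i j"
      using openin_compact_nbhd[OF f compact_cball sub] \<open>e > 0\<close> by (meson half_gt_zero)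
  qed
qed

lemma closed_hull_subset_pos_class:
  assumes "i \<ge> 1" "j \<ge> 1"
  shows "closed_hull_S_star \<subseteq> pos_class i j"
  unfolding closed_hull_S_star_def
  by (intro closure_of_minimal hull_minimal class_S_star_subset_pos_class convex_funs_pos_class
      closedin_pos_class assms)

lemma pos_class_moment_bound:
  assumes "f \<in> pos_class i j"
  shows "cmod (moment f i * moment f j - moment f (i + j)) + cmod (moment f i * moment f j) \<le> 1"
proof -
  define p q s where "p = moment f i" and "q = moment f j" and "s = moment f (i + j)"
  define d where "d = s - p * q"
  \<comment> \<open>The rotation \<open>b\<close> turns \<open>d\<close> onto the negative real
    axis, where the term \<open>2 * Re (b * d)\<close> is smallest.\<close>
  obtain b where b: "cmod b = 1" "b * d = - of_real (cmod d)"
  proof (cases "d = 0")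
    case False
    have "cmod (- (of_real (cmod d) / d)) = 1" "- (of_real (cmod d) / d) * d = - of_real (cmod d)"
      using False by (simp_all add: norm_divide)
    then show ?thesis by (rule that)
  qed (auto intro: that[of 1])
  \<comment> \<open>This \<open>a\<close> makes the completed square vanish, which is the minimum
    over \<open>a\<close>.\<close>
  define a where "a = - (b * p + cnj q)"
  have "0 \<le> pos_form a b i j f" using assms b(1) by (simp add: pos_class_def)
  also have "pos_form a b i j f = (cmod (a + b * p + cnj q))\<^sup>2 + 2 - (cmod p)\<^sup>2 - (cmod q)\<^sup>2 + 2 * Re (b * d)"
    unfolding cmod_add3_square by (simp add: pos_form_def d_def norm_mult b(1) p_def q_def s_def algebra_simps)
  also have "\<dots> = 2 - (cmod p)\<^sup>2 - (cmod q)\<^sup>2 - 2 * cmod d" by (simp add: a_def b(2))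
  finally have "2 * cmod d + (cmod p)\<^sup>2 + (cmod q)\<^sup>2 \<le> 2" by simp
  moreover have "2 * cmod (p * q) \<le> (cmod p)\<^sup>2 + (cmod q)\<^sup>2"
    using sum_squares_bound[of "cmod p" "cmod q"] by (simp add: norm_mult)
  ultimately have "cmod d + cmod (p * q) \<le> 1" by simp
  then show ?thesis by (simp add: d_def p_def q_def s_def norm_minus_commute)
qed

section \<open>The extremal functions\<close>

lemma taylor_coeff_sums:
  assumes "\<And>z. z \<in> ball 0 1 \<Longrightarrow> (\<lambda>k. c k * z ^ k) sums f z"
  shows "taylor_coeff f k = c k"
proof -
  have "f has_fps_expansion Abs_fps c"
    by (rule has_fps_expansionI, rule eventually_mono[OF eventually_nhds_in_open[of "ball 0 1" 0]])
      (use assms in auto)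
  then show ?thesis by (simp add: taylor_coeff_eqI)
qed

text \<open>The derivative of the geometric series, shifted by one. At \<open>k = 0\<close> the
  truncated exponent \<open>k - 1\<close> is harmless because the factor \<open>of_nat k\<close> is
  0.\<close>

lemma koebe_sums:
  assumes "cmod x = 1" "z \<in> ball 0 1"
  shows "(\<lambda>k. of_nat k * x ^ (k - 1) * z ^ k) sums (z / (1 - x * z)\<^sup>2)"
proof -
  have "(\<lambda>k. z * (of_nat (Suc k) * (x * z) ^ k)) sums (z * (1 / (1 - x * z)\<^sup>2))"
    using assms by (intro sums_mult geometric_deriv_sums) (simp add: norm_mult)
  then have "(\<lambda>k. of_nat (Suc k) * x ^ (Suc k - 1) * z ^ Suc k) sums (z / (1 - x * z)\<^sup>2)"
    by (simp add: power_mult_distrib mult_ac)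
  then show ?thesis by (subst (asm) sums_Suc_iff) simp
qed

text \<open>With p = (1 + y)/(1 - y) in the right half-plane, y/(1 - y)^2 = (p^2 - 1)/4. Scaling by
  t replaces p^2 by t p^2 + 1 - t; its principal root \<open>s\<close> stays in the right
  half-plane, and the inverse Cayley transform yields \<open>u\<close>.\<close>

lemma koebe_image_scale:
  assumes y: "cmod y < 1" and t: "0 \<le> t" "t \<le> 1"
  obtains u where "cmod u < 1" "u / (1 - u)\<^sup>2 = of_real t * (y / (1 - y)\<^sup>2)"
proof -
  define p where "p = (1 + y) / (1 - y)"
  define s where "s = csqrt (of_real t * p\<^sup>2 + of_real (1 - t))"
  have y1: "1 - y \<noteq> 0" using y by auto
  have "Re ((1 + y) * cnj (1 - y)) = 1 - (cmod y)\<^sup>2"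
    unfolding cmod_power2 by (simp add: power2_eq_square algebra_simps)
  then have Re_p: "0 < Re p"
    unfolding p_def Re_complex_div_gt_0 using y by (simp add: power_less_one_iff)
  have s2: "s\<^sup>2 = of_real t * p\<^sup>2 + of_real (1 - t)" by (simp add: s_def)
  \<comment> \<open>Otherwise \<open>s\<^sup>2\<close> is real and at most 0. For t > 0 this forces
    p to be real, hence t p^2 + 1 - t > 0; for t = 0 the value is 1.\<close>
  have "Re s \<noteq> 0"
  proof
    assume "Re s = 0"
    with s2 have Im: "t * (2 * Re p * Im p) = 0"
      and Re: "t * ((Re p)\<^sup>2 - (Im p)\<^sup>2) + (1 - t) = - (Im s)\<^sup>2"
      by (auto simp: complex_eq_iff power2_eq_square algebra_simps)
    show False
    proof (cases "t = 0")
      case False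
      with Im Re_p have "Im p = 0" by simp
      with Re have "t * (Re p)\<^sup>2 + (1 - t) \<le> 0" by simp
      moreover have "0 < t * (Re p)\<^sup>2" using False t Re_p by simp
      ultimately show False using t by linarith
    next
      case True
      with Re have "1 = - (Im s)\<^sup>2" by simp
      then show False using zero_le_power2[of "Im s"] by linarith
    qed
  qed
  moreover have "0 \<le> Re s" unfolding s_def by (rule Re_csqrt)
  ultimately have Re_s: "0 < Re s" by simp
  then have s1: "s + 1 \<noteq> 0" by (auto simp: complex_eq_iff)
  define u where "u = (s - 1) / (s + 1)"
  have "(cmod (s - 1))\<^sup>2 < (cmod (s + 1))\<^sup>2"
    unfolding cmod_power2 using Re_s by (simp add: power2_eq_square algebra_simps)
  then have "cmod (s - 1) < cmod (s + 1)" by (rule power2_less_imp_less) simp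
  then have "cmod u < 1" using s1 by (simp add: u_def norm_divide)
  moreover have "u / (1 - u)\<^sup>2 = of_real t * (y / (1 - y)\<^sup>2)"
  proof -
    have "1 - u = 2 / (s + 1)" using s1 by (simp add: u_def field_simps)
    then have "u / (1 - u)\<^sup>2 = u * (s + 1) * (s + 1) / 4" by (simp add: power2_eq_square)
    also have "\<dots> = (s\<^sup>2 - 1) / 4"
      using s1 by (simp add: u_def) (simp add: power2_eq_square algebra_simps)
    also have "\<dots> = of_real t * ((p\<^sup>2 - 1) / 4)" unfolding s2 by (simp add: field_simps)
    also have "(p\<^sup>2 - 1) / 4 = y / (1 - y)\<^sup>2"
      using y1 unfolding p_def power_divide by (simp add: divide_simps) (simp add: power2_eq_square algebra_simps)
    finally show ?thesis .
  qed
  ultimately show ?thesis by (rule that)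
qed

text \<open>f(z) = K(x z)/x with K(y) = y/(1 - y)^2, so starlikeness reduces to scaling the image of
  K.\<close>

lemma koebe_in_class_S_star:
  assumes x: "cmod x = 1" and f: "\<And>z. z \<in> ball 0 1 \<Longrightarrow> f z = z / (1 - x * z)\<^sup>2"
  shows "f \<in> class_S_star"
proof -
  have nz: "1 - x * z \<noteq> 0" if "z \<in> ball 0 1" for z
  proof
    assume "1 - x * z = 0"
    then have "cmod (x * z) = 1" by simp
    with that x show False by (simp add: norm_mult)
  qed
  have "(\<lambda>z. z / (1 - x * z)\<^sup>2) holomorphic_on ball 0 1"
    using nz by (intro holomorphic_intros) auto
  then have "f holomorphic_on ball 0 1" by (rule holomorphic_transform) (simp add: f)
  moreover have "inj_on f (ball 0 1)"
  proof (rule inj_onI)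
    fix z y assume z: "z \<in> ball 0 1" and y: "y \<in> ball 0 1" and eq: "f z = f y"
    then have "z * (1 - x * y)\<^sup>2 = y * (1 - x * z)\<^sup>2"
      using nz[OF z] nz[OF y] by (simp add: f field_simps)
    \<comment> \<open>The second factor cannot vanish, since the product of two points of the disc
      has modulus below 1.\<close>
    then have "(z - y) * (1 - x * z * (x * y)) = 0" by (simp add: power2_eq_square algebra_simps)
    moreover have "cmod (x * z * (x * y)) < 1"
      using mult_strict_mono[of "cmod z" 1 "cmod y" 1] z y x by (simp add: norm_mult)
    then have "1 - x * z * (x * y) \<noteq> 0" by auto
    ultimately show "z = y" by simp
  qed
  moreover have "taylor_coeff f k = of_nat k * x ^ (k - 1)" for k
    using koebe_sums[OF x] by (intro taylor_coeff_sums) (simp add: f)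
  moreover have "starlike_wrt_origin (f ` ball 0 1)"
    unfolding starlike_wrt_origin_def
  proof (intro ballI subsetI)
    fix w v assume "w \<in> f ` ball 0 1" and v: "v \<in> closed_segment 0 w"
    then obtain z where z: "z \<in> ball 0 1" "w = f z" by auto
    obtain t where t: "0 \<le> t" "t \<le> 1" "v = of_real t * w"
      using v by (auto simp: in_segment scaleR_conv_of_real)
    have "cmod (x * z) < 1" using x z by (simp add: norm_mult)
    then obtain u where u: "cmod u < 1" "u / (1 - u)\<^sup>2 = of_real t * (x * z / (1 - x * z)\<^sup>2)"
      using koebe_image_scale[OF _ t(1,2)] by metis
    have x0: "x \<noteq> 0" using x by auto
    have ball: "u / x \<in> ball 0 1" using u(1) x by (simp add: norm_divide)
    have "f (u / x) = (u / (1 - u)\<^sup>2) / x" using x0 by (simp add: f[OF ball])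
    also have "\<dots> = v" using x0 by (simp add: u(2) t(3) z(2) f[OF z(1)])
    finally show "v \<in> f ` ball 0 1" using ball by (metis imageI)
  qed
  ultimately show ?thesis by (simp add: class_S_star_def class_S_def)
qed

lemma convex_funs_hull: "convex_funs (convex_funs hull A)"
  by (rule hull_in) (auto simp: convex_funs_def)

lemma convex_funs_average:
  assumes A: "convex_funs A" and "finite I" "I \<noteq> {}" and "\<And>i. i \<in> I \<Longrightarrow> F i \<in> A"
  shows "(\<lambda>z. (\<Sum>i\<in>I. F i z) / of_nat (card I)) \<in> A"
  using assms(2-4)
proof (induction rule: finite_ne_induct)
  case (insert i I)
  define c where "c = real (card I)"
  have c: "c > 0" using insert.hyps by (simp add: c_def card_gt_0_iff)
  let ?G = "\<lambda>z. (\<Sum>i\<in>I. F i z) / of_nat (card I)"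
  have "F i \<in> A" "?G \<in> A" using insert by auto
  moreover have "1 / (c + 1) + c / (c + 1) = 1" using c by (simp add: field_simps)
  ultimately have "(\<lambda>z. of_real (1 / (c + 1)) * F i z + of_real (c / (c + 1)) * ?G z) \<in> A"
    by (intro A[unfolded convex_funs_def, rule_format]) (use c in auto)
  moreover have "of_real (1 / (c + 1)) * F i z + of_real (c / (c + 1)) * ?G z
      = (\<Sum>i\<in>insert i I. F i z) / of_nat (card (insert i I))" for z
  proof -
    define C where "C = complex_of_real c"
    have "C \<noteq> 0" "C + 1 \<noteq> 0" using c by (auto simp: C_def complex_eq_iff)
    moreover have "of_nat (card I) = C" by (simp add: C_def c_def)
    ultimately show ?thesis using insert.hyps
      by (simp add: C_def[symmetric] add_divide_distrib add.commute)
  qed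
  ultimately show ?case by simp
qed simp

lemma hull_subset_closed_hull: "convex_funs hull class_S_star \<subseteq> closed_hull_S_star"
proof -
  have "convex_funs {f. f holomorphic_on ball 0 1}"
    unfolding convex_funs_def by (auto intro!: holomorphic_intros)
  then have "convex_funs hull class_S_star \<subseteq> topspace compact_convergence_topology"
    unfolding topspace_compact_convergence
    by (intro hull_minimal) (auto simp: class_S_star_def class_S_def)
  then show ?thesis unfolding closed_hull_S_star_def by (rule closure_of_subset)
qed

text \<open>The exponents with nonzero coefficient are \<open>g j\<close> = 1 + j N. Splitting the
  coefficient as 1 + j N separates a geometric series in z^N from a Koebe series in z^N.\<close>

lemma extremal_sums:
  fixes z :: complex
  assumes N: "N > 0" and z: "z \<in> ball 0 1"
  shows "(\<lambda>k. (if N dvd k - 1 then of_nat k else 0) * z ^ k) sums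
           (z / (1 - z ^ N) + of_nat N * z ^ Suc N / (1 - z ^ N)\<^sup>2)"
proof -
  define g where "g j = Suc (j * N)" for j
  have y: "cmod (z ^ N) < 1" using z N by (simp add: norm_power power_less_one_iff)
  have "(\<lambda>j. z * (z ^ N) ^ j + of_nat N * z * (of_nat j * 1 ^ (j - 1) * (z ^ N) ^ j)) sums
      (z * (1 / (1 - z ^ N)) + of_nat N * z * (z ^ N / (1 - 1 * z ^ N)\<^sup>2))"
    using y by (intro sums_add sums_mult geometric_sums koebe_sums) auto
  then have "(\<lambda>j. of_nat (g j) * z ^ g j) sums (z / (1 - z ^ N) + of_nat N * z ^ Suc N / (1 - z ^ N)\<^sup>2)"
    by (simp add: g_def algebra_simps power_mult[symmetric])
  moreover have "of_nat (g j) * z ^ g j = (if N dvd g j - 1 then of_nat (g j) else 0) * z ^ g j" for j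
    by (simp add: g_def)
  ultimately have "(\<lambda>j. (if N dvd g j - 1 then of_nat (g j) else 0) * z ^ g j) sums
      (z / (1 - z ^ N) + of_nat N * z ^ Suc N / (1 - z ^ N)\<^sup>2)"
    by simp
  moreover have "strict_mono g" using N by (auto simp: strict_mono_def g_def)
  \<comment> \<open>The index 0 is not in the range of \<open>g\<close>, although
    \<open>N dvd 0 - 1\<close> holds by truncation; its coefficient is still
    \<open>of_nat 0\<close>.\<close>
  moreover have "(if N dvd k - 1 then of_nat k else 0) * z ^ k = 0" if "k \<notin> range g" for k
  proof (cases "k = 0")
    case False
    have "\<not> N dvd k - 1"
    proof
      assume "N dvd k - 1"
      then obtain j where "k - 1 = N * j" by auto
      with False have "k = g j" by (simp add: g_def mult.commute)
      with that show False by auto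
    qed
    then show ?thesis by simp
  qed simp
  ultimately show ?thesis
    using sums_mono_reindex[of g "\<lambda>k. (if N dvd k - 1 then of_nat k else 0) * z ^ k"] by blast
qed

text \<open>The l-th power of the q-th root is the q-th power of the l-th root \<open>x\<close>, so
  the sum is geometric with ratio \<open>x\<close>, and \<open>x ^ N = 1\<close>.\<close>

lemma sum_powers_root_unity:
  assumes "N > 0"
  shows "(\<Sum>q<N. (exp (2 * of_real pi * \<i> * of_nat q / of_nat N)) ^ l) = (if N dvd l then of_nat N else (0::complex))"
proof -
  define x where "x = exp (2 * of_real pi * \<i> * of_nat l / of_nat N)"
  have "exp (2 * of_real pi * \<i> * of_nat q / of_nat N) ^ l = x ^ q" for q
    by (simp add: x_def mult_ac flip: exp_of_nat_mult)
  moreover have "x = 1 \<longleftrightarrow> N dvd l"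
    unfolding x_def using assms by (intro complex_root_unity_eq_1) simp
  moreover have "x ^ N = 1"
    using assms by (simp add: x_def flip: exp_of_nat_mult) (metis exp_two_pi_i exp_of_nat_mult mult.commute power_one)
  ultimately show ?thesis by (simp add: sum_gp_strict)
qed

text \<open>Averaging over the roots of unity keeps exactly the Koebe coefficients with
  \<open>N dvd k - 1\<close>.\<close>

lemma extremal_in_closed_hull:
  assumes N: "N > 0"
  shows "(\<lambda>z. z / (1 - z ^ N) + of_nat N * z ^ Suc N / (1 - z ^ N)\<^sup>2) \<in> closed_hull_S_star"
    (is "?E \<in> _")
proof -
  define x where "x q = exp (2 * of_real pi * \<i> * of_nat q / of_nat N)" for q
  have x: "cmod (x q) = 1" for q by (simp add: x_def norm_exp_eq_Re)
  \<comment> \<open>Only values in the disc matter for membership; off it, where the average would disagree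
    with \<open>?E\<close> at the poles because of $x/0 = 0$, we prescribe the value of \<open>?E\<close>.\<close>
  define F where "F q z = (if z \<in> ball 0 1 then z / (1 - x q * z)\<^sup>2 else ?E z)" for q z
  have "F q \<in> class_S_star" for q
    by (rule koebe_in_class_S_star[OF x[of q]]) (simp add: F_def)
  then have "(\<lambda>z. (\<Sum>q<N. F q z) / of_nat (card {..<N})) \<in> convex_funs hull class_S_star"
    using N by (intro convex_funs_average convex_funs_hull hull_inc) auto
  moreover have "(\<Sum>q<N. F q z) / of_nat (card {..<N}) = ?E z" for z
  proof (cases "z \<in> ball 0 1")
    case True
    have "(\<lambda>k. (\<Sum>q<N. of_nat k * x q ^ (k - 1) * z ^ k) / of_nat N) sums
        ((\<Sum>q<N. z / (1 - x q * z)\<^sup>2) / of_nat N)"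
      by (intro sums_divide sums_sum koebe_sums x True)
    moreover have "(\<Sum>q<N. of_nat k * x q ^ (k - 1) * z ^ k) / of_nat N
        = (if N dvd k - 1 then of_nat k else 0) * z ^ k" for k
    proof -
      have "(\<Sum>q<N. of_nat k * x q ^ (k - 1) * z ^ k) = of_nat k * z ^ k * (\<Sum>q<N. x q ^ (k - 1))"
        by (simp add: sum_distrib_left mult_ac)
      then show ?thesis
        using N unfolding x_def sum_powers_root_unity[OF N] by simp
    qed
    ultimately have "(\<Sum>q<N. z / (1 - x q * z)\<^sup>2) / of_nat N = ?E z"
      using extremal_sums[OF N True] sums_unique2 by (simp only:) blast
    then show ?thesis using True by (simp add: F_def)
  qed (use N in \<open>simp add: F_def\<close>)
  ultimately have "?E \<in> convex_funs hull class_S_star" by simp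
  then show ?thesis using hull_subset_closed_hull by blast
qed

section \<open>The form with a parameter, and the conclusion\<close>

text \<open>Forwards, split l x - y = (x - y) - (1 - l) x. Backwards, test on the circle |1 - l| =
  1, where the maximum is 1 and some l makes the triangle inequality an equality.\<close>

lemma max_bound_iff:
  fixes x y :: complex
  shows "cmod (x - y) + cmod x \<le> 1 \<longleftrightarrow> (\<forall>l. cmod (l * x - y) \<le> max 1 (cmod (1 - l)))"
proof
  assume le: "cmod (x - y) + cmod x \<le> 1"
  show "\<forall>l. cmod (l * x - y) \<le> max 1 (cmod (1 - l))"
  proof
    fix l
    define M where "M = max 1 (cmod (1 - l))"
    have M: "1 \<le> M" "cmod (1 - l) \<le> M" by (auto simp: M_def)
    have "l * x - y = (x - y) - (1 - l) * x" by (simp add: algebra_simps)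
    then have "cmod (l * x - y) \<le> cmod (x - y) + cmod (1 - l) * cmod x"
      by (metis norm_mult norm_triangle_ineq4)
    also have "\<dots> \<le> M * cmod (x - y) + M * cmod x"
      using M by (intro add_mono mult_right_mono) (auto simp: mult_le_cancel_right1)
    also have "\<dots> = M * (cmod (x - y) + cmod x)" by (simp add: distrib_left)
    also have "\<dots> \<le> M" using le M by (simp add: mult_left_le)
    finally show "cmod (l * x - y) \<le> max 1 (cmod (1 - l))" by (simp add: M_def)
  qed
next
  assume bound: "\<forall>l. cmod (l * x - y) \<le> max 1 (cmod (1 - l))"
  obtain u where u: "cmod u = 1" "cmod (x - y - u * x) = cmod (x - y) + cmod x"
  proof (cases "x = 0 \<or> x = y")
    case True
    then show ?thesis by (intro that[of 1]) auto
  next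
    case False
    define v where "v = (x - y) / of_real (cmod (x - y))"
    \<comment> \<open>\<open>- u * x\<close> has the modulus of \<open>x\<close> and the direction
      \<open>v\<close> of \<open>x - y\<close>, so the two lengths add.\<close>
    define u where "u = - (v * of_real (cmod x) / x)"
    have v: "cmod v = 1" using False by (simp add: v_def norm_divide)
    have "cmod u = 1" using False v by (simp add: u_def norm_divide norm_mult)
    moreover have "x - y - u * x = v * of_real (cmod (x - y) + cmod x)"
      using False by (simp add: u_def v_def field_simps)
    then have "cmod (x - y - u * x) = cmod (x - y) + cmod x"
      by (simp only: norm_mult v norm_of_real) simp
    ultimately show ?thesis by (rule that)
  qed
  have "(1 - u) * x - y = x - y - u * x" by (simp add: algebra_simps)
  with bound[rule_format, of "1 - u"] u show "cmod (x - y) + cmod x \<le> 1" by simp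
qed

theorem theorem7:
  fixes m n :: nat and koebe extremal :: "complex \<Rightarrow> complex"
  assumes "m \<ge> 2" and "n \<ge> 2"
  defines "koebe \<equiv> \<lambda>z. z / (1 - z)^2"
    and "extremal \<equiv> \<lambda>z. z / (1 - z^(m + n - 2)) +
            of_nat (m + n - 2) * z^(m + n - 1) / (1 - z^(m + n - 2))^2"
  shows
    "(\<forall>f \<in> closed_hull_S_star.
        cmod (taylor_coeff f m * taylor_coeff f n / of_nat (m * n)
                - taylor_coeff f (m + n - 1) / of_nat (m + n - 1))
          + cmod (taylor_coeff f m * taylor_coeff f n) / real (m * n) \<le> 1)
     \<and> (\<forall>f \<in> closed_hull_S_star. \<forall>l :: complex.
        cmod (l * taylor_coeff f m * taylor_coeff f n - taylor_coeff f (m + n - 1))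
          \<le> real (m + n - 1) * max 1 (cmod (1 - of_nat (m * n) / of_nat (m + n - 1) * l)))
     \<and> (\<forall>f. f holomorphic_on unit_disc \<longrightarrow>
        (cmod (taylor_coeff f m * taylor_coeff f n / of_nat (m * n)
                - taylor_coeff f (m + n - 1) / of_nat (m + n - 1))
          + cmod (taylor_coeff f m * taylor_coeff f n) / real (m * n) \<le> 1
         \<longleftrightarrow>
         (\<forall>l :: complex.
            cmod (l * taylor_coeff f m * taylor_coeff f n - taylor_coeff f (m + n - 1))
              \<le> real (m + n - 1) * max 1 (cmod (1 - of_nat (m * n) / of_nat (m + n - 1) * l)))))
     \<and> koebe \<in> closed_hull_S_star
     \<and> extremal \<in> closed_hull_S_star
     \<and> (\<forall>f \<in> {koebe, extremal}.
        cmod (taylor_coeff f m * taylor_coeff f n / of_nat (m * n)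
                - taylor_coeff f (m + n - 1) / of_nat (m + n - 1))
          + cmod (taylor_coeff f m * taylor_coeff f n) / real (m * n) = 1)
     \<and> (\<forall>l :: complex. cmod (1 - of_nat (m * n) / of_nat (m + n - 1) * l) \<ge> 1 \<longrightarrow>
        cmod (l * taylor_coeff koebe m * taylor_coeff koebe n - taylor_coeff koebe (m + n - 1))
          = real (m + n - 1) * max 1 (cmod (1 - of_nat (m * n) / of_nat (m + n - 1) * l)))
     \<and> (\<forall>l :: complex. cmod (1 - of_nat (m * n) / of_nat (m + n - 1) * l) < 1 \<longrightarrow>
        cmod (l * taylor_coeff extremal m * taylor_coeff extremal n
                - taylor_coeff extremal (m + n - 1))
          = real (m + n - 1) * max 1 (cmod (1 - of_nat (m * n) / of_nat (m + n - 1) * l)))"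
proof -
  define X where "X f = taylor_coeff f m * taylor_coeff f n / of_nat (m * n)" for f
  define Y where "Y f = taylor_coeff f (m + n - 1) / of_nat (m + n - 1)" for f
  define c :: complex where "c = of_nat (m * n) / of_nat (m + n - 1)"
  have c0: "c \<noteq> 0" 
    unfolding c_def divide_eq_0_iff of_nat_eq_0_iff using assms(1,2) by simp
  have norm_X: "cmod (taylor_coeff f m * taylor_coeff f n) / real (m * n) = cmod (X f)" for f
    unfolding X_def norm_divide norm_of_nat ..
  have scale: "cmod (l * taylor_coeff f m * taylor_coeff f n - taylor_coeff f (m + n - 1))
      = real (m + n - 1) * cmod (c * l * X f - Y f)" for l f
  proof -
    have "l * a * b - d = M * (K / M * l * (a * b / K) - d / M)" if "K \<noteq> 0" "M \<noteq> 0"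
      for K M a b d :: complex
      using that by (simp add: right_diff_distrib)
    moreover have "m * n \<noteq> 0" "m + n - 1 \<noteq> 0" using assms(1,2) by auto
    then have "complex_of_nat (m * n) \<noteq> 0" "complex_of_nat (m + n - 1) \<noteq> 0"
      by (simp_all only: of_nat_eq_0_iff not_False_eq_True)
    ultimately have "l * taylor_coeff f m * taylor_coeff f n - taylor_coeff f (m + n - 1)
        = of_nat (m + n - 1) * (c * l * X f - Y f)"
      unfolding X_def Y_def c_def by blast
    then show ?thesis by (simp only: norm_mult norm_of_nat)
  qed
  have pos: "0 < real (m + n - 1)" using assms(1) by simp
  \<comment> \<open>In the normalised quantities the parameter is \<open>c * l\<close>; as
    \<open>c\<close> is nonzero, it ranges over all complex numbers and \<open>max_bound_iff\<close>
    applies.\<close>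
  have equiv: "cmod (X f - Y f) + cmod (X f) \<le> 1 \<longleftrightarrow>
      (\<forall>l. real (m + n - 1) * cmod (c * l * X f - Y f) \<le> real (m + n - 1) * max 1 (cmod (1 - c * l)))" for f
  proof -
    have "(\<forall>l. cmod (l * X f - Y f) \<le> max 1 (cmod (1 - l)))
        \<longleftrightarrow> (\<forall>l. cmod (c * l * X f - Y f) \<le> max 1 (cmod (1 - c * l)))"
    proof
      assume *: "\<forall>l. cmod (c * l * X f - Y f) \<le> max 1 (cmod (1 - c * l))"
      show "\<forall>l. cmod (l * X f - Y f) \<le> max 1 (cmod (1 - l))"
      proof
        fix l show "cmod (l * X f - Y f) \<le> max 1 (cmod (1 - l))"
          using *[rule_format, of "l / c"] c0 by simp
      qed
    qed blast
    then show ?thesis unfolding max_bound_iff using pos by simp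
  qed
  have bound: "cmod (X f - Y f) + cmod (X f) \<le> 1" if f: "f \<in> closed_hull_S_star" for f
  proof -
    have idx: "Suc (m - 1) = m" "Suc (n - 1) = n" "Suc (m - 1 + (n - 1)) = m + n - 1"
      using assms(1,2) by auto
    have "X f = moment f (m - 1) * moment f (n - 1)" "Y f = moment f (m - 1 + (n - 1))"
      unfolding X_def Y_def moment_def idx by simp_all
    moreover have "f \<in> pos_class (m - 1) (n - 1)"
      using f assms(1,2) by (intro subsetD[OF closed_hull_subset_pos_class]) auto
    ultimately show ?thesis using pos_class_moment_bound by metis
  qed
  have "koebe \<in> class_S_star" unfolding koebe_def by (rule koebe_in_class_S_star[of 1]) simp_all
  then have koebe_hull: "koebe \<in> closed_hull_S_star"
    by (intro subsetD[OF hull_subset_closed_hull] hull_inc)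
  have "taylor_coeff koebe k = of_nat k" for k
    unfolding koebe_def using koebe_sums[of 1] by (intro taylor_coeff_sums) simp
  then have XY_koebe: "X koebe = 1" "Y koebe = 1"
    using assms(1,2) by (simp_all add: X_def Y_def del: of_nat_diff)
  define N where "N = m + n - 2"
  have N: "N > 0" "m + n - 1 = Suc N" using assms(1,2) by (auto simp: N_def)
  have ext: "extremal = (\<lambda>z. z / (1 - z ^ N) + of_nat N * z ^ Suc N / (1 - z ^ N)\<^sup>2)"
    unfolding extremal_def N(2) N_def ..
  then have ext_hull: "extremal \<in> closed_hull_S_star"
    using extremal_in_closed_hull[OF N(1)] by simp
  have ext_coeff: "taylor_coeff extremal k = (if N dvd k - 1 then of_nat k else 0)" for k
    unfolding ext by (intro taylor_coeff_sums extremal_sums N)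
  \<comment> \<open>\<open>m - 1\<close> is positive and smaller than
    \<open>N = (m - 1) + (n - 1)\<close>, so the m-th coefficient vanishes, and with it
    \<open>X extremal\<close>.\<close>
  have "\<not> N dvd m - 1" using assms(1,2) by (intro nat_dvd_not_less) (auto simp: N_def)
  then have XY_ext: "X extremal = 0" "Y extremal = 1"
    unfolding X_def Y_def ext_coeff N(2) by (simp_all del: of_nat_Suc)
  show ?thesis
    unfolding norm_X scale X_def[symmetric] Y_def[symmetric] c_def[symmetric]
  proof (intro conjI ballI allI impI)
    show "cmod (X f - Y f) + cmod (X f) = 1" if "f \<in> {koebe, extremal}" for f
      using that XY_koebe XY_ext by auto
    show "real (m + n - 1) * cmod (c * l * X koebe - Y koebe) = real (m + n - 1) * max 1 (cmod (1 - c * l))"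
      if "1 \<le> cmod (1 - c * l)" for l
      using that by (simp add: XY_koebe norm_minus_commute)
    show "real (m + n - 1) * cmod (c * l * X extremal - Y extremal) = real (m + n - 1) * max 1 (cmod (1 - c * l))"
      if "cmod (1 - c * l) < 1" for l
      using that by (simp add: XY_ext)
    show "cmod (X f - Y f) + cmod (X f) \<le> 1" if "f \<in> closed_hull_S_star" for f
      by (rule bound[OF that])
    show "real (m + n - 1) * cmod (c * l * X f - Y f) \<le> real (m + n - 1) * max 1 (cmod (1 - c * l))"
      if "f \<in> closed_hull_S_star" for f l
      using bound[OF that] unfolding equiv by (rule spec)
    show "cmod (X f - Y f) + cmod (X f) \<le> 1 \<longleftrightarrow>
        (\<forall>l. real (m + n - 1) * cmod (c * l * X f - Y f) \<le> real (m + n - 1) * max 1 (cmod (1 - c * l)))" for f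
      by (rule equiv)
  qed (rule koebe_hull ext_hull)+
qed

end
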